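(* Let $\mathfrak{A}$ be a residuated lattice and $F$ a filter of $\mathfrak{A}$. Then $(\Omega_{F}(\mathfrak{A});\cap,\vee^{\omega_{F}},F,A)$ is a bounded distributive lattice (with least element $F$ and greatest element $A$), where for any $G,H\in\Omega_{F}(\mathfrak{A})$, $G\vee^{\omega_{F}}H=\omega_{F}(I_{G}\curlyvee I_{H})$, with $I_G, I_H$ ideals of $\ell(\mathfrak{A})$ such that $G=\omega_F(I_G)$ and $H=\omega_F(I_H)$.
   Context: A residuated lattice is an algebra $\mathfrak{A}=(A;\vee,\wedge,\odot,\rightarrow,0,1)$ such that $\ell(\mathfrak{A})=(A;\vee,\wedge,0,1)$ is a bounded lattice, $(A;\odot,1)$ is a commutative monoid, and $x\odot y\leq z$ iff $x\leq y\rightarrow z$ for all $x,y,z\in A$. A filter of $\mathfrak{A}$ is a non-empty subset $F\subseteq A$ such that $x,y\in F$ implies $x\odot y\in F$, and $x\in F$, $y\in A$ implies $x\vee y\in F$. An ideal of $\ell(\mathfrak{A})$ is a non-empty subset $I\subseteq A$ closed under $\vee$ and downward closed; $I\curlyvee J$ denotes the ideal generated by $I\cup J$. For a filter $F$ and $X\subseteq A$, $\omega_{F}(X)=\{a\in A\mid x\vee a\in F\text{ for some }x\in X\}$. A filter $H$ is called an $\omega_F$-filter if $H=\omega_F(I)$ for some ideal $I$ of $\ell(\mathfrak{A})$; $\Omega_F(\mathfrak{A})$ is the set of all $\omega_F$-filters, ordered by inclusion. *)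

theory Defs
  imports "HOL-Algebra.Lattice" "HOL.Hull"
begin

hide_const (open) Lattice.sup Lattice.inf Order.top

text \<open>
  The lattice \<open>\<ell>(A)\<close> is given by \<open>sup\<close>, \<open>inf\<close>, \<open>bot\<close>, \<open>top\<close>, and the monoid by \<open>*\<close>, \<open>1\<close>.
  The axiom \<open>one_eq_top\<close> says that the unit of the monoid and the greatest element
  are the same constant of the signature. The case \<open>bot = top\<close> is not excluded.
\<close>

class residuated_lattice = Lattices.bounded_lattice + comm_monoid_mult +
  fixes residuum :: "'a \<Rightarrow> 'a \<Rightarrow> 'a"  (infixr \<open>\<leadsto>\<close> 60)
  assumes one_eq_top: "1 = top"
    and residuation: "x * y \<le> z \<longleftrightarrow> x \<le> (y \<leadsto> z)"

definition rl_filter :: "'a::residuated_lattice set \<Rightarrow> bool" where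
  "rl_filter F \<longleftrightarrow> F \<noteq> {} \<and> (\<forall>x\<in>F. \<forall>y\<in>F. x * y \<in> F) \<and> (\<forall>x\<in>F. \<forall>y. sup x y \<in> F)"

definition lattice_ideal :: "'a::Lattices.lattice set \<Rightarrow> bool" where
  "lattice_ideal I \<longleftrightarrow>
     I \<noteq> {} \<and> (\<forall>x\<in>I. \<forall>y\<in>I. sup x y \<in> I) \<and> (\<forall>x\<in>I. \<forall>y. y \<le> x \<longrightarrow> y \<in> I)"

definition ideal_join :: "'a::Lattices.lattice set \<Rightarrow> 'a set \<Rightarrow> 'a set"  (infixl \<open>\<curlyvee>\<close> 65) where
  "I \<curlyvee> J = lattice_ideal hull (I \<union> J)"

definition omega :: "'a::residuated_lattice set \<Rightarrow> 'a set \<Rightarrow> 'a set" where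
  "omega F X = {a. \<exists>x\<in>X. sup x a \<in> F}"

definition omega_filters :: "'a::residuated_lattice set \<Rightarrow> 'a set set" where
  "omega_filters F = {H. rl_filter H \<and> (\<exists>I. lattice_ideal I \<and> H = omega F I)}"

definition Omega :: "'a::residuated_lattice set \<Rightarrow> 'a set gorder" where
  "Omega F = \<lparr>carrier = omega_filters F, eq = (=), le = (\<subseteq>)\<rparr>"

locale bounded_distributive_lattice = Lattice.bounded_lattice +
  assumes meet_join_distrib:
    "\<lbrakk>x \<in> carrier L; y \<in> carrier L; z \<in> carrier L\<rbrakk>
      \<Longrightarrow> x \<sqinter> (y \<squnion> z) = (x \<sqinter> y) \<squnion> (x \<sqinter> z)"

end

theory Submission
  imports Defs
begin

text \<open>
  Everything reduces to computations with ideals. The engine is that multiplication is isotone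
  and preserves binary joins (being a left adjoint) and that \<open>x * y\<close> lies below both factors.
  Consequently, if \<open>sup x a\<close> and \<open>sup y a\<close> lie in a filter, then so does \<open>sup (x * y) a\<close>: the
  product acts as a substitute for the meet \<open>inf x y\<close>, over which \<open>sup\<close> need not
  distribute because the underlying lattice is arbitrary. For members \<open>x\<close>, \<open>y\<close> of two ideals the
  product lies in both, which gives \<open>omega F I \<inter> omega F J = omega F (I \<inter> J)\<close>, and the same
  computation turns witnesses \<open>x \<in> I\<close> and \<open>sup y z\<close> (with \<open>y \<in> J\<close> and \<open>z \<in> K\<close>) into the witness
  \<open>sup (x * y) (x * z)\<close>, which gives distributivity.

  That \<open>omega F (I \<curlyvee> J)\<close> is the least upper bound of \<open>omega F I\<close> and \<open>omega F J\<close> among the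
  \<open>\<omega>\<^sub>F\<close>-filters has a different reason: if both are contained in \<open>omega F K\<close>, then in
  \<open>sup (sup x y) a \<in> F\<close> the witnesses \<open>x \<in> I\<close> and \<open>y \<in> J\<close> can be exchanged, one after the other,
  for witnesses in \<open>K\<close>. In particular the join does not depend on the chosen ideals.
\<close>

section \<open>Products in residuated lattices and filters\<close>

lemma mult_sup_le:
  fixes x :: "'a::residuated_lattice"
  assumes "x * y \<le> w" "x * z \<le> w"
  shows "x * sup y z \<le> w"
proof -
  have "y \<le> x \<leadsto> w" "z \<le> x \<leadsto> w"
    using assms by (simp_all add: residuation[symmetric] mult.commute)
  then have "sup y z * x \<le> w"
    by (simp add: residuation)
  then show ?thesis
    by (simp add: mult.commute)
qed

lemma mult_le_left:
  fixes x :: "'a::residuated_lattice"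
  shows "x * y \<le> x"
proof -
  have "1 \<le> x \<leadsto> x"
    by (simp add: residuation[symmetric])
  then have "y \<le> x \<leadsto> x"
    by (simp add: one_eq_top top_unique)
  then show ?thesis
    by (simp add: residuation[symmetric] mult.commute)
qed

lemma mult_le_right:
  fixes x :: "'a::residuated_lattice"
  shows "x * y \<le> y"
  by (metis mult.commute mult_le_left)

lemma filter_upward: "rl_filter F \<Longrightarrow> x \<in> F \<Longrightarrow> x \<le> y \<Longrightarrow> y \<in> F"
  unfolding rl_filter_def by (metis sup.absorb2)

lemma filter_top: "rl_filter F \<Longrightarrow> top \<in> F"
  using filter_upward top_greatest unfolding rl_filter_def by blast

text \<open>
  The four products are the terms of the expansion of \<open>sup x a * sup y b\<close>, which lies in \<open>F\<close>.
  Combining two witnesses into one, for products, meets and distributivity, amounts to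
  bounding these terms.
\<close>

lemma filter_expand_product:
  assumes "rl_filter F" "sup x a \<in> F" "sup y b \<in> F"
    and "x * y \<le> w" "x * b \<le> w" "a * y \<le> w" "a * b \<le> w"
  shows "w \<in> F"
proof -
  have "y * sup x a \<le> w" "b * sup x a \<le> w"
    using assms(4-7) by (simp_all add: mult_sup_le mult.commute)
  then have "sup x a * sup y b \<le> w"
    by (simp add: mult_sup_le mult.commute)
  moreover have "sup x a * sup y b \<in> F"
    using assms(1-3) by (simp add: rl_filter_def)
  ultimately show ?thesis
    using assms(1) filter_upward by blast
qed

section \<open>Ideals\<close>

lemma ideal_nonempty: "lattice_ideal I \<Longrightarrow> \<exists>x. x \<in> I"
  by (auto simp: lattice_ideal_def)

lemma ideal_sup: "lattice_ideal I \<Longrightarrow> x \<in> I \<Longrightarrow> y \<in> I \<Longrightarrow> sup x y \<in> I"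
  by (simp add: lattice_ideal_def)

lemma ideal_downward: "lattice_ideal I \<Longrightarrow> x \<in> I \<Longrightarrow> y \<le> x \<Longrightarrow> y \<in> I"
  unfolding lattice_ideal_def by blast

lemma ideal_bot:
  fixes I :: "'a::{Lattices.lattice, order_bot} set"
  shows "lattice_ideal I \<Longrightarrow> bot \<in> I"
  by (meson bot_least ideal_downward ideal_nonempty)

lemma lattice_ideal_bot: "lattice_ideal {bot :: 'a::{Lattices.lattice, order_bot}}"
  by (simp add: lattice_ideal_def bot_unique)

lemma lattice_ideal_UNIV: "lattice_ideal UNIV"
  by (simp add: lattice_ideal_def)

text \<open>The infimum of two members witnesses that the intersection is nonempty.\<close>

lemma lattice_ideal_Int:
  assumes "lattice_ideal I" "lattice_ideal J"
  shows "lattice_ideal (I \<inter> J)"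
proof -
  obtain x y where "x \<in> I" "y \<in> J"
    using assms ideal_nonempty by meson
  then have "inf x y \<in> I \<inter> J"
    using ideal_downward[OF assms(1) _ inf_le1] ideal_downward[OF assms(2) _ inf_le2] by simp
  then have "I \<inter> J \<noteq> {}"
    by blast
  moreover have "sup a b \<in> I \<inter> J" if "a \<in> I \<inter> J" "b \<in> I \<inter> J" for a b
    using that ideal_sup[OF assms(1)] ideal_sup[OF assms(2)] by simp
  moreover have "b \<in> I \<inter> J" if "a \<in> I \<inter> J" "b \<le> a" for a b
    using that ideal_downward[OF assms(1)] ideal_downward[OF assms(2)] by blast
  ultimately show ?thesis
    unfolding lattice_ideal_def by (intro conjI ballI allI impI)
qed

lemma lattice_ideal_below_sups:
  assumes I: "lattice_ideal I" and J: "lattice_ideal J"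
  shows "lattice_ideal {a. \<exists>x\<in>I. \<exists>y\<in>J. a \<le> sup x y}" (is "lattice_ideal ?S")
proof -
  obtain x0 y0 where "x0 \<in> I" "y0 \<in> J"
    using I J ideal_nonempty by meson
  then have "?S \<noteq> {}"
    by blast
  moreover have "sup a b \<in> ?S" if ab: "a \<in> ?S" "b \<in> ?S" for a b
  proof -
    obtain x y x' y' where
      w: "x \<in> I" "y \<in> J" "a \<le> sup x y" "x' \<in> I" "y' \<in> J" "b \<le> sup x' y'"
      using ab by blast
    have "sup a b \<le> sup (sup x y) (sup x' y')"
      using w by (intro sup_mono)
    also have "\<dots> = sup (sup x x') (sup y y')"
      by (simp add: ac_simps)
    finally show ?thesis
      using w I J ideal_sup by blast
  qed
  moreover have "b \<in> ?S" if "a \<in> ?S" "b \<le> a" for a b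
    using that order_trans by blast
  ultimately show ?thesis
    unfolding lattice_ideal_def by (intro conjI ballI allI impI)
qed

text \<open>
  Ideals are nonempty, so in a lattice without least element they are not closed under arbitrary
  intersection, and a hull need not be an ideal. The explicit description settles this for the
  join of two ideals, and it splits a witness from the join into witnesses from \<open>I\<close> and \<open>J\<close>.
\<close>

lemma ideal_join_eq:
  assumes I: "lattice_ideal I" and J: "lattice_ideal J"
  shows "I \<curlyvee> J = {a. \<exists>x\<in>I. \<exists>y\<in>J. a \<le> sup x y}" (is "_ = ?S")
  unfolding ideal_join_def
proof (rule hull_unique)
  obtain x0 y0 where "x0 \<in> I" "y0 \<in> J"
    using I J ideal_nonempty by meson
  then show "I \<union> J \<subseteq> ?S"
    using sup_ge1 sup_ge2 by blast
  show "lattice_ideal ?S"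
    by (rule lattice_ideal_below_sups[OF I J])
next
  fix T assume "I \<union> J \<subseteq> T" and T: "lattice_ideal T"
  then have "sup x y \<in> T" if "x \<in> I" "y \<in> J" for x y
    using that ideal_sup[OF T] by blast
  then show "?S \<subseteq> T"
    using ideal_downward[OF T] by blast
qed

lemma lattice_ideal_join:
  "lattice_ideal I \<Longrightarrow> lattice_ideal J \<Longrightarrow> lattice_ideal (I \<curlyvee> J)"
  by (simp add: ideal_join_eq lattice_ideal_below_sups)

lemma ideal_join_upper1: "I \<subseteq> I \<curlyvee> J"
  using hull_subset[of "I \<union> J" lattice_ideal] by (simp add: ideal_join_def)

lemma ideal_join_upper2: "J \<subseteq> I \<curlyvee> J"
  using hull_subset[of "I \<union> J" lattice_ideal] by (simp add: ideal_join_def)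

section \<open>The sets \<open>omega F I\<close>\<close>

lemma omega_mono: "I \<subseteq> J \<Longrightarrow> omega F I \<subseteq> omega F J"
  by (auto simp: omega_def)

lemma omega_bot: "omega F {bot} = F"
  by (simp add: omega_def)

lemma omega_UNIV:
  assumes "rl_filter F"
  shows "omega F UNIV = UNIV"
proof -
  have "sup top a \<in> F" for a
    using filter_top[OF assms] by simp
  then show ?thesis
    unfolding omega_def by blast
qed

text \<open>
  For closure under products, witnesses \<open>x\<close> for \<open>a\<close> and \<open>y\<close> for \<open>b\<close> give the witness
  \<open>sup x y\<close> for \<open>a * b\<close>.
\<close>

lemma omega_filter:
  fixes F :: "'a::residuated_lattice set"
  assumes F: "rl_filter F" and I: "lattice_ideal I"
  shows "rl_filter (omega F I)"
proof -
  have "top \<in> omega F I"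
    using filter_top[OF F] ideal_bot[OF I] by (auto simp: omega_def)
  moreover have "a * b \<in> omega F I" if ab: "a \<in> omega F I" "b \<in> omega F I" for a b
  proof -
    obtain x y where w: "x \<in> I" "sup x a \<in> F" "y \<in> I" "sup y b \<in> F"
      using ab by (auto simp: omega_def)
    have "sup (sup x y) (a * b) \<in> F"
      using F w(2,4)
      by (rule filter_expand_product)
        (auto intro: le_supI1 le_supI2 mult_le_left mult_le_right)
    then show ?thesis
      using w I ideal_sup by (auto simp: omega_def)
  qed
  moreover have "sup a b \<in> omega F I" if a: "a \<in> omega F I" for a b
  proof -
    obtain x where "x \<in> I" "sup x a \<in> F"
      using a by (auto simp: omega_def)
    then have "sup x (sup a b) \<in> F"
      using F unfolding sup_assoc[symmetric] by (simp add: rl_filter_def)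
    with \<open>x \<in> I\<close> show ?thesis
      by (auto simp: omega_def)
  qed
  ultimately show ?thesis
    unfolding rl_filter_def by blast
qed

lemma carrier_Omega:
  assumes "rl_filter F"
  shows "carrier (Omega F) = {omega F I | I. lattice_ideal I}"
  using assms omega_filter by (auto simp: Omega_def omega_filters_def)

lemma omega_in_Omega:
  "rl_filter F \<Longrightarrow> lattice_ideal I \<Longrightarrow> omega F I \<in> carrier (Omega F)"
  unfolding carrier_Omega by blast

lemma Omega_cases:
  assumes "rl_filter F" "G \<in> carrier (Omega F)"
  obtains I where "lattice_ideal I" "G = omega F I"
  using assms unfolding carrier_Omega[OF assms(1)] by blast

lemma le_Omega [simp]: "x \<sqsubseteq>\<^bsub>Omega F\<^esub> y \<longleftrightarrow> x \<subseteq> y"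
  by (simp add: Omega_def)

lemma eq_Omega [simp]: "eq (Omega F) = (=)"
  by (simp add: Omega_def)

text \<open>
  The product \<open>x * y\<close> of witnesses from the two ideals is a common witness; the meet \<open>inf x y\<close>
  is one only because it lies above the product.
\<close>

lemma omega_Int:
  assumes F: "rl_filter F" and I: "lattice_ideal I" and J: "lattice_ideal J"
  shows "omega F I \<inter> omega F J = omega F (I \<inter> J)"
proof
  show "omega F (I \<inter> J) \<subseteq> omega F I \<inter> omega F J"
    by (simp add: omega_mono)
  show "omega F I \<inter> omega F J \<subseteq> omega F (I \<inter> J)"
  proof
    fix a assume "a \<in> omega F I \<inter> omega F J"
    then obtain x y where w: "x \<in> I" "sup x a \<in> F" "y \<in> J" "sup y a \<in> F"
      by (auto simp: omega_def)
    have "sup (x * y) a \<in> F"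
      using F w(2,4)
      by (rule filter_expand_product) (auto intro: le_supI2 mult_le_left mult_le_right)
    moreover have "x * y \<in> I \<inter> J"
      using w I J ideal_downward mult_le_left mult_le_right by blast
    ultimately show "a \<in> omega F (I \<inter> J)"
      by (auto simp: omega_def)
  qed
qed

lemma omega_ideal_join_iff:
  assumes F: "rl_filter F" and I: "lattice_ideal I" and J: "lattice_ideal J"
  shows "a \<in> omega F (I \<curlyvee> J) \<longleftrightarrow> (\<exists>x\<in>I. \<exists>y\<in>J. sup (sup x y) a \<in> F)"
proof
  assume "a \<in> omega F (I \<curlyvee> J)"
  then obtain u x y where "sup u a \<in> F" "x \<in> I" "y \<in> J" "u \<le> sup x y"
    unfolding omega_def ideal_join_eq[OF I J] by blast
  then show "\<exists>x\<in>I. \<exists>y\<in>J. sup (sup x y) a \<in> F"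
    using filter_upward[OF F] sup_mono order_refl by metis
next
  assume "\<exists>x\<in>I. \<exists>y\<in>J. sup (sup x y) a \<in> F"
  then show "a \<in> omega F (I \<curlyvee> J)"
    unfolding omega_def ideal_join_eq[OF I J] using order_refl by blast
qed

text \<open>
  The witness \<open>x \<in> I\<close> is traded for some \<open>z \<in> K\<close> by reading \<open>sup x (sup y a) \<in> F\<close> as
  \<open>sup y a \<in> omega F I\<close>; what remains is a statement about \<open>y\<close> alone, treated in the same way.
\<close>

lemma omega_ideal_join_least:
  assumes F: "rl_filter F"
    and I: "lattice_ideal I" and J: "lattice_ideal J" and K: "lattice_ideal K"
    and IK: "omega F I \<subseteq> omega F K" and JK: "omega F J \<subseteq> omega F K"
  shows "omega F (I \<curlyvee> J) \<subseteq> omega F K"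
proof
  fix a assume "a \<in> omega F (I \<curlyvee> J)"
  then obtain x y where x: "x \<in> I" and y: "y \<in> J" and "sup (sup x y) a \<in> F"
    using omega_ideal_join_iff[OF F I J] by blast
  then have "sup y a \<in> omega F I"
    by (auto simp: omega_def sup_assoc)
  then obtain z where z: "z \<in> K" "sup z (sup y a) \<in> F"
    using IK by (auto simp: omega_def)
  then have "sup z a \<in> omega F J"
    using y by (auto simp: omega_def sup_left_commute)
  then obtain v where "v \<in> K" "sup v (sup z a) \<in> F"
    using JK by (auto simp: omega_def)
  then have "sup v z \<in> K" "sup (sup v z) a \<in> F"
    using z K ideal_sup by (auto simp: sup_assoc)
  then show "a \<in> omega F K"
    by (auto simp: omega_def)
qed

lemma omega_distrib:
  assumes F: "rl_filter F"
    and I: "lattice_ideal I" and J: "lattice_ideal J" and K: "lattice_ideal K"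
  shows "omega F (I \<inter> (J \<curlyvee> K)) = omega F ((I \<inter> J) \<curlyvee> (I \<inter> K))"
proof
  have "(I \<inter> J) \<curlyvee> (I \<inter> K) \<subseteq> I \<inter> (J \<curlyvee> K)"
    unfolding ideal_join_def[of "I \<inter> J"]
    using ideal_join_upper1[of J K] ideal_join_upper2[of K J]
    by (intro hull_minimal lattice_ideal_Int[OF I lattice_ideal_join[OF J K]]) auto
  then show "omega F ((I \<inter> J) \<curlyvee> (I \<inter> K)) \<subseteq> omega F (I \<inter> (J \<curlyvee> K))"
    by (rule omega_mono)
  show "omega F (I \<inter> (J \<curlyvee> K)) \<subseteq> omega F ((I \<inter> J) \<curlyvee> (I \<inter> K))"
  proof
    fix a assume "a \<in> omega F (I \<inter> (J \<curlyvee> K))"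
    then have "a \<in> omega F I" "a \<in> omega F (J \<curlyvee> K)"
      using omega_Int[OF F I lattice_ideal_join[OF J K]] by blast+
    then obtain x y z where
      w: "x \<in> I" "sup x a \<in> F" "y \<in> J" "z \<in> K" "sup (sup y z) a \<in> F"
      using omega_ideal_join_iff[OF F J K] by (auto simp: omega_def)
    \<comment> \<open>The only one of the four products not absorbed by \<open>a\<close>.\<close>
    have "x * sup y z \<le> sup (sup (x * y) (x * z)) a"
      by (rule mult_sup_le) (simp_all add: le_supI1)
    then have "sup (sup (x * y) (x * z)) a \<in> F"
      by (rule filter_expand_product[OF F w(2,5)])
        (auto intro: le_supI2 mult_le_left mult_le_right)
    moreover have "x * y \<in> I \<inter> J" "x * z \<in> I \<inter> K"
      using w I J K ideal_downward mult_le_left mult_le_right by blast+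
    ultimately show "a \<in> omega F ((I \<inter> J) \<curlyvee> (I \<inter> K))"
      using omega_ideal_join_iff[OF F lattice_ideal_Int[OF I J] lattice_ideal_Int[OF I K]]
      by blast
  qed
qed

section \<open>The lattice of \<open>\<omega>\<^sub>F\<close>-filters\<close>

lemma Omega_lub:
  assumes F: "rl_filter F" and I: "lattice_ideal I" and J: "lattice_ideal J"
  shows "is_lub (Omega F) (omega F (I \<curlyvee> J)) {omega F I, omega F J}"
proof (rule least_UpperI)
  fix G assume "G \<in> {omega F I, omega F J}"
  then show "G \<sqsubseteq>\<^bsub>Omega F\<^esub> omega F (I \<curlyvee> J)"
    using omega_mono[OF ideal_join_upper1[of I J], of F]
      omega_mono[OF ideal_join_upper2[of J I], of F] by auto
next
  fix G assume "G \<in> Upper (Omega F) {omega F I, omega F J}"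
  then have G: "G \<in> carrier (Omega F)" "omega F I \<subseteq> G" "omega F J \<subseteq> G"
    using I J by (simp_all add: Upper_def omega_in_Omega[OF F])
  obtain K where "lattice_ideal K" "G = omega F K"
    using Omega_cases[OF F G(1)] .
  with G show "omega F (I \<curlyvee> J) \<sqsubseteq>\<^bsub>Omega F\<^esub> G"
    using omega_ideal_join_least[OF F I J] by simp
next
  show "{omega F I, omega F J} \<subseteq> carrier (Omega F)"
    using I J by (simp add: omega_in_Omega[OF F])
  show "omega F (I \<curlyvee> J) \<in> carrier (Omega F)"
    using lattice_ideal_join[OF I J] by (rule omega_in_Omega[OF F])
qed

lemma Omega_glb:
  assumes F: "rl_filter F" and I: "lattice_ideal I" and J: "lattice_ideal J"
  shows "is_glb (Omega F) (omega F I \<inter> omega F J) {omega F I, omega F J}"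
proof (rule greatest_LowerI)
  fix G assume "G \<in> {omega F I, omega F J}"
  then show "omega F I \<inter> omega F J \<sqsubseteq>\<^bsub>Omega F\<^esub> G"
    by auto
next
  fix G assume "G \<in> Lower (Omega F) {omega F I, omega F J}"
  then show "G \<sqsubseteq>\<^bsub>Omega F\<^esub> omega F I \<inter> omega F J"
    using I J by (simp add: Lower_def omega_in_Omega[OF F])
next
  show "{omega F I, omega F J} \<subseteq> carrier (Omega F)"
    using I J by (simp add: omega_in_Omega[OF F])
  show "omega F I \<inter> omega F J \<in> carrier (Omega F)"
    unfolding omega_Int[OF F I J] using lattice_ideal_Int[OF I J] by (rule omega_in_Omega[OF F])
qed

lemma Omega_bottom:
  fixes F :: "'a::residuated_lattice set"
  assumes F: "rl_filter F"
  shows "least (Omega F) F (carrier (Omega F))"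
proof -
  have "F \<in> carrier (Omega F)"
    using omega_in_Omega[OF F lattice_ideal_bot] by (simp add: omega_bot)
  moreover have "F \<subseteq> G" if G: "G \<in> carrier (Omega F)" for G
  proof -
    obtain I where "lattice_ideal I" "G = omega F I"
      using Omega_cases[OF F G] .
    then show ?thesis
      using omega_mono[of "{bot}" I F] omega_bot[of F] ideal_bot[of I] by simp
  qed
  ultimately show ?thesis
    by (simp add: least_def)
qed

lemma Omega_top:
  fixes F :: "'a::residuated_lattice set"
  assumes F: "rl_filter F"
  shows "greatest (Omega F) UNIV (carrier (Omega F))"
proof -
  have "UNIV \<in> carrier (Omega F)"
    using omega_in_Omega[OF F lattice_ideal_UNIV] by (simp add: omega_UNIV[OF F])
  then show ?thesis
    by (simp add: greatest_def)
qed

lemma Omega_bounded_lattice: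
  assumes F: "rl_filter F"
  shows "Lattice.bounded_lattice (Omega F)"
proof unfold_locales
  show "\<exists>s. is_lub (Omega F) s {x, y}"
    if c: "x \<in> carrier (Omega F)" "y \<in> carrier (Omega F)" for x y
  proof -
    obtain I J where "lattice_ideal I" "x = omega F I" "lattice_ideal J" "y = omega F J"
      using Omega_cases[OF F c(1)] Omega_cases[OF F c(2)] by metis
    then show ?thesis
      using Omega_lub[OF F] by blast
  qed
  show "\<exists>s. is_glb (Omega F) s {x, y}"
    if c: "x \<in> carrier (Omega F)" "y \<in> carrier (Omega F)" for x y
  proof -
    obtain I J where "lattice_ideal I" "x = omega F I" "lattice_ideal J" "y = omega F J"
      using Omega_cases[OF F c(1)] Omega_cases[OF F c(2)] by metis
    then show ?thesis
      using Omega_glb[OF F] by blast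
  qed
  show "\<exists>x. least (Omega F) x (carrier (Omega F))"
    using Omega_bottom[OF F] by blast
  show "\<exists>x. greatest (Omega F) x (carrier (Omega F))"
    using Omega_top[OF F] by blast
qed auto

lemma Omega_join:
  assumes F: "rl_filter F" and I: "lattice_ideal I" and J: "lattice_ideal J"
  shows "omega F I \<squnion>\<^bsub>Omega F\<^esub> omega F J = omega F (I \<curlyvee> J)"
proof -
  interpret Lattice.bounded_lattice "Omega F"
    by (rule Omega_bounded_lattice[OF F])
  have "omega F I \<in> carrier (Omega F)" "omega F J \<in> carrier (Omega F)"
    using I J by (simp_all add: omega_in_Omega[OF F])
  then show ?thesis
    using least_unique[OF _ Omega_lub[OF F I J]]
    by (intro joinI[where P = "\<lambda>s. s = omega F (I \<curlyvee> J)"])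
qed

lemma Omega_meet:
  assumes F: "rl_filter F" and G: "G \<in> carrier (Omega F)" and H: "H \<in> carrier (Omega F)"
  shows "G \<sqinter>\<^bsub>Omega F\<^esub> H = G \<inter> H"
proof -
  interpret Lattice.bounded_lattice "Omega F"
    by (rule Omega_bounded_lattice[OF F])
  obtain I J where "lattice_ideal I" "G = omega F I" "lattice_ideal J" "H = omega F J"
    using Omega_cases[OF F G] Omega_cases[OF F H] by metis
  then have "is_glb (Omega F) (G \<inter> H) {G, H}"
    using Omega_glb[OF F] by simp
  then show ?thesis
    using G H greatest_unique by (intro meetI[where P = "\<lambda>s. s = G \<inter> H"])
qed

lemma Omega_distributive:
  assumes F: "rl_filter F"
  shows "bounded_distributive_lattice (Omega F)"
proof -
  interpret Lattice.bounded_lattice "Omega F"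
    by (rule Omega_bounded_lattice[OF F])
  show ?thesis
  proof
    fix x y z
    assume c: "x \<in> carrier (Omega F)" "y \<in> carrier (Omega F)" "z \<in> carrier (Omega F)"
    obtain I J K where
      ideals: "lattice_ideal I" "lattice_ideal J" "lattice_ideal K"
      and xyz: "x = omega F I" "y = omega F J" "z = omega F K"
      using Omega_cases[OF F c(1)] Omega_cases[OF F c(2)] Omega_cases[OF F c(3)] by metis
    have "x \<sqinter>\<^bsub>Omega F\<^esub> (y \<squnion>\<^bsub>Omega F\<^esub> z) = omega F I \<inter> omega F (J \<curlyvee> K)"
      using c ideals by (simp add: Omega_meet[OF F] xyz Omega_join[OF F, symmetric])
    also have "\<dots> = omega F ((I \<inter> J) \<curlyvee> (I \<inter> K))"
      using ideals by (simp add: omega_Int[OF F] lattice_ideal_join omega_distrib[OF F])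
    also have "\<dots> = (x \<inter> y) \<squnion>\<^bsub>Omega F\<^esub> (x \<inter> z)"
      using ideals by (simp add: xyz omega_Int[OF F] Omega_join[OF F] lattice_ideal_Int)
    also have "\<dots> = (x \<sqinter>\<^bsub>Omega F\<^esub> y) \<squnion>\<^bsub>Omega F\<^esub> (x \<sqinter>\<^bsub>Omega F\<^esub> z)"
      using c by (simp add: Omega_meet[OF F])
    finally show "x \<sqinter>\<^bsub>Omega F\<^esub> (y \<squnion>\<^bsub>Omega F\<^esub> z)
      = (x \<sqinter>\<^bsub>Omega F\<^esub> y) \<squnion>\<^bsub>Omega F\<^esub> (x \<sqinter>\<^bsub>Omega F\<^esub> z)" .
  qed
qed

theorem proposition3p6:
  fixes F :: "'a::residuated_lattice set"
  assumes "rl_filter F"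
  shows "bounded_distributive_lattice (Omega F)
    \<and> \<bottom>\<^bsub>Omega F\<^esub> = F
    \<and> \<top>\<^bsub>Omega F\<^esub> = UNIV
    \<and> (\<forall>G \<in> carrier (Omega F). \<forall>H \<in> carrier (Omega F).
         G \<sqinter>\<^bsub>Omega F\<^esub> H = G \<inter> H
         \<and> (\<forall>I\<^sub>G I\<^sub>H. lattice_ideal I\<^sub>G \<and> lattice_ideal I\<^sub>H
               \<and> G = omega F I\<^sub>G \<and> H = omega F I\<^sub>H
              \<longrightarrow> G \<squnion>\<^bsub>Omega F\<^esub> H = omega F (I\<^sub>G \<curlyvee> I\<^sub>H)))"
proof -
  interpret Lattice.bounded_lattice "Omega F"
    by (rule Omega_bounded_lattice[OF assms])
  have "F = \<bottom>\<^bsub>Omega F\<^esub>"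
    using Omega_bottom[OF assms] by (intro bottom_eq) (auto simp: least_def)
  moreover have "UNIV = \<top>\<^bsub>Omega F\<^esub>"
    using Omega_top[OF assms] by (intro top_eq) (auto simp: greatest_def)
  ultimately show ?thesis
    using Omega_distributive[OF assms] Omega_meet[OF assms] Omega_join[OF assms] by simp
qed

end
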